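(* $\diamondsuit(\mathfrak{c})$ is equivalent to Jensen's principle $\diamondsuit$, where $\mathfrak{c}$ denotes the Borel invariant $(\mathbb{R},\mathbb{R},=)$.
   Context: $2^{<\omega_1}$ is the set of all functions from a countable ordinal into $2=\{0,1\}$. For a Borel subset $A$ of a Polish space, a map $F:2^{<\omega_1}\to A$ is Borel if for every $\delta<\omega_1$ the restriction of $F$ to $2^\delta$ (with the product topology) is a Borel map. For a Borel invariant $(A,B,E)$ (in particular $A$, $B$ and $E\subseteq A\times B$ are Borel subsets of Polish spaces), $\diamondsuit(A,B,E)$ is the statement: for every Borel map $F:2^{<\omega_1}\to A$ there is $g:\omega_1\to B$ such that for every $f:\omega_1\to 2$ the set $\{\alpha\in\omega_1: F(f\restriction\alpha)\,E\,g(\alpha)\}$ is stationary in $\omega_1$. Thus $\diamondsuit(\mathfrak{c})$ is $\diamondsuit(\mathbb{R},\mathbb{R},=)$. $\diamondsuit$ (without parameter) is the statement: there is a sequence $A_\alpha$ ($\alpha<\omega_1$) with $A_\alpha\subseteq\alpha$ such that for every $X\subseteq\omega_1$ the set $\{\alpha<\omega_1: X\cap\alpha=A_\alpha\}$ is stationary. *)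

theory Defs
  imports "HOL-Analysis.Analysis" "HOL-Library.Countable_Set_Type"
begin

text \<open>
  The elements of this type are the countable ordinals; the ordinal \<open>\<alpha> < \<omega>\<^sub>1\<close>, as the set of its
  predecessors, is \<open>{..<\<alpha>}\<close>.
\<close>

typedef omega1 = "Field (cardSuc natLeq)"
proof -
  have "\<not> finite (Field (cardSuc natLeq))"
    using cardSuc_finite[OF natLeq_Card_order] by (simp add: Field_natLeq)
  then show ?thesis by (metis ex_in_conv finite.emptyI)
qed

lemma wo_cardSuc_natLeq: "Well_order (cardSuc natLeq)"
  using cardSuc_Card_order[OF natLeq_Card_order] by (auto simp: card_order_on_def)

instantiation omega1 :: wellorder
begin

definition less_eq_omega1 :: "omega1 \<Rightarrow> omega1 \<Rightarrow> bool" where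
  "x \<le> y \<longleftrightarrow> (Rep_omega1 x, Rep_omega1 y) \<in> cardSuc natLeq"

definition less_omega1 :: "omega1 \<Rightarrow> omega1 \<Rightarrow> bool" where
  "x < y \<longleftrightarrow> x \<le> y \<and> x \<noteq> (y :: omega1)"

instance
proof -
  note wo = wo_cardSuc_natLeq[unfolded well_order_on_def linear_order_on_def
      partial_order_on_def preorder_on_def]
  have anti: "x = y" if "x \<le> y" "y \<le> x" for x y :: omega1
    using that wo Rep_omega1_inject unfolding less_eq_omega1_def by (blast dest: antisymD)
  show "OFCLASS(omega1, wellorder_class)"
  proof
    fix x y z :: omega1 and P :: "omega1 \<Rightarrow> bool" and a :: omega1
    show "x < y \<longleftrightarrow> x \<le> y \<and> \<not> y \<le> x"
      using anti wo Rep_omega1 by (auto simp: less_omega1_def less_eq_omega1_def refl_on_def)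
    show "x \<le> x"
      using wo Rep_omega1 by (auto simp: less_eq_omega1_def refl_on_def)
    show "x \<le> z" if "x \<le> y" "y \<le> z"
      using that wo unfolding less_eq_omega1_def by (blast dest: transD)
    show "x = y" if "x \<le> y" "y \<le> x"
      using that by (rule anti)
    show "x \<le> y \<or> y \<le> x"
    proof (cases "x = y")
      case True
      then show ?thesis using wo Rep_omega1 by (auto simp: less_eq_omega1_def refl_on_def)
    next
      case False
      then have "Rep_omega1 x \<noteq> Rep_omega1 y" by (simp add: Rep_omega1_inject)
      then show ?thesis
        using wo Rep_omega1[of x] Rep_omega1[of y] unfolding less_eq_omega1_def total_on_def by blast
    qed
    show "P a" if step: "\<And>x. (\<And>y. y < x \<Longrightarrow> P y) \<Longrightarrow> P x"
    proof -
      have "wf (inv_image (cardSuc natLeq - Id) Rep_omega1)"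
        using wo by (blast intro: wf_inv_image)
      moreover have "inv_image (cardSuc natLeq - Id) Rep_omega1 = {(y, x). y < x}"
        by (auto simp: inv_image_def less_omega1_def less_eq_omega1_def Rep_omega1_inject)
      ultimately have "wf {(y, x :: omega1). y < x}" by simp
      then show ?thesis by (rule wf_induct_rule) (use step in blast)
    qed
  qed
qed

end

context
  includes cardinal_syntax
begin

lemma uncountable_omega1: "uncountable (UNIV :: omega1 set)"
proof
  assume "countable (UNIV :: omega1 set)"
  then have "countable (Field (cardSuc natLeq))"
    by (metis countable_image type_definition.Rep_range type_definition_omega1)
  then have "|Field (cardSuc natLeq)| \<le>o natLeq"
    using countable_card_le_natLeq by blast
  then have "cardSuc natLeq \<le>o natLeq"
    using card_of_Field_ordIso[OF cardSuc_Card_order[OF natLeq_Card_order]]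
      ordIso_ordLeq_trans ordIso_symmetric by blast
  then show False
    using cardSuc_greater[OF natLeq_Card_order] not_ordLess_ordLeq by blast
qed

lemma countable_lessThan_omega1: "countable {..<\<alpha> :: omega1}"
proof -
  have "Rep_omega1 ` {..<\<alpha>} \<subseteq> underS (cardSuc natLeq) (Rep_omega1 \<alpha>)"
    by (auto simp: underS_def less_omega1_def less_eq_omega1_def Rep_omega1_inject)
  moreover have "|underS (cardSuc natLeq) (Rep_omega1 \<alpha>)| <o cardSuc natLeq"
    using card_of_underS[OF cardSuc_Card_order[OF natLeq_Card_order] Rep_omega1] .
  then have "countable (underS (cardSuc natLeq) (Rep_omega1 \<alpha>))"
    by (simp add: countable_card_le_natLeq
        cardSuc_ordLeq_ordLess[OF natLeq_Card_order card_of_Card_order])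
  ultimately have "countable (Rep_omega1 ` {..<\<alpha>})"
    using countable_subset by blast
  then show ?thesis
    by (rule countable_image_inj_on) (simp add: inj_on_def Rep_omega1_inject)
qed

end

text \<open>
  In the closure condition, \<open>\<delta>\<close> is necessarily a limit ordinal: no \<open>\<beta>\<close> fits between \<open>\<alpha>\<close> and its
  successor.
\<close>

definition club :: "omega1 set \<Rightarrow> bool" where
  "club C \<longleftrightarrow>
     (\<forall>\<alpha>. \<exists>\<beta>\<in>C. \<alpha> < \<beta>) \<and>
     (\<forall>\<delta>. {..<\<delta>} \<noteq> {} \<and> (\<forall>\<alpha><\<delta>. \<exists>\<beta>\<in>C. \<alpha> < \<beta> \<and> \<beta> < \<delta>) \<longrightarrow> \<delta> \<in> C)"

definition stationary :: "omega1 set \<Rightarrow> bool" where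
  "stationary S \<longleftrightarrow> (\<forall>C. club C \<longrightarrow> S \<inter> C \<noteq> {})"

definition two_pow_top :: "omega1 \<Rightarrow> (omega1 \<Rightarrow> bool) topology" where
  "two_pow_top \<delta> = product_topology (\<lambda>_. discrete_topology UNIV) {..<\<delta>}"

definition borel_of_top :: "'a topology \<Rightarrow> 'a measure" where
  "borel_of_top X = sigma (topspace X) {U. openin X U}"

text \<open>
  An extensional function on \<open>{..<\<delta>}\<close> does not determine \<open>\<delta>\<close>, so a function \<open>s : \<delta> \<rightarrow> 2\<close> is
  represented in \<open>2\<^bsup><\<omega>1\<^esup>\<close> by the pair \<open>(\<delta>, s)\<close>.
\<close>

definition seqs :: "(omega1 \<times> (omega1 \<Rightarrow> bool)) set" where
  "seqs = (SIGMA \<delta>:UNIV. {..<\<delta>} \<rightarrow>\<^sub>E UNIV)"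

definition restr :: "(omega1 \<Rightarrow> bool) \<Rightarrow> omega1 \<Rightarrow> omega1 \<times> (omega1 \<Rightarrow> bool)" where
  "restr f \<alpha> = (\<alpha>, restrict f {..<\<alpha>})"

definition borel_map ::
    "'a::polish_space set \<Rightarrow> (omega1 \<times> (omega1 \<Rightarrow> bool) \<Rightarrow> 'a) \<Rightarrow> bool" where
  "borel_map A F \<longleftrightarrow> F \<in> seqs \<rightarrow> A \<and>
     (\<forall>\<delta>. (\<lambda>s. F (\<delta>, s)) \<in> borel_of_top (two_pow_top \<delta>) \<rightarrow>\<^sub>M restrict_space borel A)"

text \<open>
  The usual requirement that \<open>A\<close> and \<open>B\<close> have size at most the continuum is automatic for subsets
  of Polish spaces.
\<close>

definition borel_invariant ::
    "'a::polish_space set \<Rightarrow> 'b::polish_space set \<Rightarrow> ('a \<times> 'b) set \<Rightarrow> bool" where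
  "borel_invariant A B E \<longleftrightarrow>
     A \<in> sets borel \<and> B \<in> sets borel \<and> E \<in> sets borel \<and> E \<subseteq> A \<times> B \<and>
     (\<forall>a\<in>A. \<exists>b\<in>B. (a, b) \<in> E) \<and> \<not> (\<exists>b\<in>B. \<forall>a\<in>A. (a, b) \<in> E)"

lemma borel_invariant_continuum:
  "borel_invariant (UNIV :: real set) (UNIV :: real set) {(x, y). x = y}"
proof -
  have "closed {z :: real \<times> real. fst z = snd z}"
    by (intro closed_Collect_eq continuous_intros)
  then have "{(x, y :: real). x = y} \<in> sets borel"
    by (simp add: case_prod_beta' borel_closed)
  moreover have "\<exists>a. a \<noteq> (b :: real)" for b
    by (rule exI[of _ "b + 1"]) simp
  ultimately show ?thesis by (auto simp: borel_invariant_def)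
qed

text \<open>Meaningful when \<open>borel_invariant A B E\<close> holds.\<close>

definition diamond_inv ::
    "'a::polish_space set \<Rightarrow> 'b::polish_space set \<Rightarrow> ('a \<times> 'b) set \<Rightarrow> bool" where
  "diamond_inv A B E \<longleftrightarrow>
     (\<forall>F. borel_map A F \<longrightarrow>
       (\<exists>g. (\<forall>\<alpha>. g \<alpha> \<in> B) \<and>
         (\<forall>f. stationary {\<alpha>. (F (restr f \<alpha>), g \<alpha>) \<in> E})))"

definition jensen_diamond :: bool where
  "jensen_diamond \<longleftrightarrow>
     (\<exists>A :: omega1 \<Rightarrow> omega1 set. (\<forall>\<alpha>. A \<alpha> \<subseteq> {..<\<alpha>}) \<and>
       (\<forall>X. stationary {\<alpha>. X \<inter> {..<\<alpha>} = A \<alpha>}))"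

end

theory Submission
  imports Defs
begin

text \<open>
  Jensen's sequence guesses the initial segments of every set, so applying \<open>F\<close> to its members
  guesses the values of \<open>F\<close> along every branch.

  Conversely, it suffices to find one Borel map \<open>F\<close> that is injective on each level \<open>2\<^sup>\<delta>\<close>: a
  correct guess of the value \<open>F (f \<restriction> \<alpha>)\<close> then determines \<open>f \<restriction> \<alpha>\<close>, so decoding the guesses gives
  Jensen's sequence. Such an \<open>F\<close> exists because \<open>\<delta>\<close> is countable: an enumeration of \<open>\<delta>\<close> turns the
  members of \<open>2\<^sup>\<delta>\<close> into sequences of digits \<open>0\<close> and \<open>1\<close>, and such sequences, read in base three,
  are distinct reals. The Borel condition speaks of each level separately, so the enumerations of
  different \<open>\<delta>\<close> can be chosen independently.
\<close>

text \<open>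
  In base two, distinct sequences can have the same value: \<open>0111...\<close> and \<open>1000...\<close> do. In base
  three with digits \<open>0\<close> and \<open>1\<close> this cannot happen.
\<close>

definition ternary_code :: "(nat \<Rightarrow> bool) \<Rightarrow> real" where
  "ternary_code x = (\<Sum>n. of_bool (x n) * (1/3) ^ n)"

lemma summable_ternary_code: "summable (\<lambda>n. of_bool (x n) * (1/3 :: real) ^ n)"
  by (rule summable_comparison_test'[of "\<lambda>n. (1/3 :: real) ^ n" 0])
    (auto intro: summable_geometric)

lemma ternary_code_nonneg: "0 \<le> ternary_code x"
  unfolding ternary_code_def by (intro suminf_nonneg summable_ternary_code) simp

lemma ternary_code_le: "ternary_code x \<le> 3/2"
proof -
  have "ternary_code x \<le> (\<Sum>n. (1/3 :: real) ^ n)"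
    unfolding ternary_code_def
    by (intro suminf_le summable_ternary_code summable_geometric) auto
  also have "\<dots> = 3/2"
    by (subst suminf_geometric) auto
  finally show ?thesis .
qed

lemma ternary_code_shift:
  "ternary_code x = of_bool (x 0) + ternary_code (\<lambda>n. x (Suc n)) / 3"
proof -
  have "ternary_code x = of_bool (x 0) + (\<Sum>n. of_bool (x (Suc n)) * (1/3 :: real) ^ Suc n)"
    using suminf_split_head[OF summable_ternary_code[of x]] by (simp add: ternary_code_def)
  also have "(\<Sum>n. of_bool (x (Suc n)) * (1/3 :: real) ^ Suc n) = ternary_code (\<lambda>n. x (Suc n)) / 3"
    using suminf_divide[OF summable_ternary_code[of "\<lambda>n. x (Suc n)"], of 3]
    by (simp add: ternary_code_def)
  finally show ?thesis .
qed

text \<open>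
  A leading digit \<open>1\<close> contributes \<open>1\<close>, while all later digits together contribute at most \<open>1/2\<close>.
\<close>

lemma ternary_code_eq_imp_head_eq:
  assumes "ternary_code x = ternary_code y"
  shows "x 0 = y 0"
  using assms ternary_code_shift[of x] ternary_code_shift[of y]
    ternary_code_nonneg[of "\<lambda>n. x (Suc n)"] ternary_code_nonneg[of "\<lambda>n. y (Suc n)"]
    ternary_code_le[of "\<lambda>n. x (Suc n)"] ternary_code_le[of "\<lambda>n. y (Suc n)"]
  by (cases "x 0"; cases "y 0") auto

text \<open>
  Once the leading digits are known to agree, they can be subtracted, so the shifted sequences
  have equal codes too.
\<close>

lemma ternary_code_eqD: "ternary_code x = ternary_code y \<Longrightarrow> x n = y n"
proof (induction n arbitrary: x y)
  case 0
  then show ?case by (rule ternary_code_eq_imp_head_eq)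
next
  case (Suc n)
  have "ternary_code (\<lambda>n. x (Suc n)) = ternary_code (\<lambda>n. y (Suc n))"
    using Suc.prems ternary_code_eq_imp_head_eq[OF Suc.prems]
      ternary_code_shift[of x] ternary_code_shift[of y] by simp
  then show ?case by (rule Suc.IH)
qed

text \<open>
  The guard \<open>e \<in> {..<\<delta>}\<close> matters for \<open>\<delta> = 0\<close>, where \<^const>\<open>from_nat_into\<close> has an arbitrary value.
\<close>

definition level_code :: "omega1 \<times> (omega1 \<Rightarrow> bool) \<Rightarrow> real" where
  "level_code = (\<lambda>(\<delta>, s). ternary_code (\<lambda>n. let e = from_nat_into {..<\<delta>} n in e \<in> {..<\<delta>} \<and> s e))"

lemma level_code_inj:
  assumes "level_code (\<delta>, s) = level_code (\<delta>, t)" and "\<xi> < \<delta>"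
  shows "s \<xi> = t \<xi>"
proof -
  obtain n where "from_nat_into {..<\<delta>} n = \<xi>"
    using from_nat_into_surj[OF countable_lessThan_omega1, of \<xi> \<delta>] assms(2) by auto
  with ternary_code_eqD[OF assms(1)[unfolded level_code_def prod.case], of n] assms(2)
  show ?thesis by simp
qed

lemma coordinate_in_borel_of_top:
  assumes "\<xi> < \<delta>"
  shows "{s \<in> {..<\<delta>} \<rightarrow>\<^sub>E UNIV. s \<xi>} \<in> sets (borel_of_top (two_pow_top \<delta>))"
proof -
  have "openin (two_pow_top \<delta>) {s \<in> topspace (two_pow_top \<delta>). s \<xi> \<in> {True}}"
    unfolding two_pow_top_def using assms
    by (intro openin_continuous_map_preimage[OF continuous_map_product_projection]) auto
  then have "openin (two_pow_top \<delta>) {s \<in> {..<\<delta>} \<rightarrow>\<^sub>E UNIV. s \<xi>}"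
    by (simp add: two_pow_top_def)
  moreover have "{U. openin X U} \<subseteq> Pow (topspace X)" for X :: "'z topology"
    by (auto dest: openin_subset)
  ultimately show ?thesis
    unfolding borel_of_top_def by (subst sets_measure_of) auto
qed

text \<open>
  On a fixed level, each digit is constant or a single coordinate, and a series of measurable
  functions is measurable.
\<close>

lemma borel_map_level_code: "borel_map UNIV level_code"
proof -
  have "(\<lambda>s. level_code (\<delta>, s)) \<in> borel_measurable (borel_of_top (two_pow_top \<delta>))" for \<delta>
  proof -
    let ?M = "borel_of_top (two_pow_top \<delta>)"
    have space: "space ?M = {..<\<delta>} \<rightarrow>\<^sub>E UNIV"
      by (simp add: borel_of_top_def two_pow_top_def space_measure_of_conv)
    have digit: "Measurable.pred ?M (\<lambda>s. e \<in> {..<\<delta>} \<and> s e)" for e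
      using coordinate_in_borel_of_top[of e \<delta>] by (cases "e < \<delta>") (auto simp: pred_def space)
    have "(\<lambda>s. of_bool (e \<in> {..<\<delta>} \<and> s e) :: real) \<in> borel_measurable ?M" for e
      unfolding of_bool_def using digit[of e] by (intro measurable_If measurable_const) auto
    then show ?thesis
      unfolding level_code_def ternary_code_def Let_def prod.case
      by (intro borel_measurable_suminf borel_measurable_times borel_measurable_const)
  qed
  then show ?thesis by (simp add: borel_map_def)
qed

lemma stationary_mono: "stationary S \<Longrightarrow> S \<subseteq> T \<Longrightarrow> stationary T"
  unfolding stationary_def by blast

lemma jensen_diamond_guesses_values:
  assumes jensen_diamond
  shows "\<exists>g. \<forall>f. stationary {\<alpha>. F (restr f \<alpha>) = g \<alpha>}"
proof -
  obtain A where A: "stationary {\<alpha>. X \<inter> {..<\<alpha>} = A \<alpha>}" for X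
    using assms unfolding jensen_diamond_def by blast
  have "stationary {\<alpha>. F (restr f \<alpha>) = F (restr (\<lambda>\<xi>. \<xi> \<in> A \<alpha>) \<alpha>)}" for f
  proof (rule stationary_mono[OF A[of "{\<xi>. f \<xi>}"]], clarify)
    fix \<alpha> assume "{\<xi>. f \<xi>} \<inter> {..<\<alpha>} = A \<alpha>"
    then have "restr f \<alpha> = restr (\<lambda>\<xi>. \<xi> \<in> A \<alpha>) \<alpha>"
      by (auto simp: restr_def restrict_def fun_eq_iff)
    then show "F (restr f \<alpha>) = F (restr (\<lambda>\<xi>. \<xi> \<in> A \<alpha>) \<alpha>)" by simp
  qed
  then show ?thesis by (intro exI[of _ "\<lambda>\<alpha>. F (restr (\<lambda>\<xi>. \<xi> \<in> A \<alpha>) \<alpha>)"]) blast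
qed

text \<open>
  The decoded set consists of the \<open>\<xi>\<close> at which some \<open>s\<close> coded by \<open>g \<alpha>\<close> is true; by injectivity
  all such \<open>s\<close> agree below \<open>\<alpha>\<close>, and the set is empty when \<open>g \<alpha>\<close> codes nothing.
\<close>

lemma guessing_injective_code_imp_jensen_diamond:
  assumes inj: "\<And>\<delta> s t \<xi>. F (\<delta>, s) = F (\<delta>, t) \<Longrightarrow> \<xi> < \<delta> \<Longrightarrow> s \<xi> = t \<xi>"
    and guess: "\<And>f. stationary {\<alpha>. F (restr f \<alpha>) = g \<alpha>}"
  shows jensen_diamond
proof -
  define A where "A \<alpha> = {\<xi>. \<xi> < \<alpha> \<and> (\<exists>s. F (\<alpha>, s) = g \<alpha> \<and> s \<xi>)}" for \<alpha>
  have "stationary {\<alpha>. X \<inter> {..<\<alpha>} = A \<alpha>}" for X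
  proof (rule stationary_mono[OF guess[of "\<lambda>\<xi>. \<xi> \<in> X"]], clarify)
    fix \<alpha> assume *: "F (restr (\<lambda>\<xi>. \<xi> \<in> X) \<alpha>) = g \<alpha>"
    let ?t = "restrict (\<lambda>\<xi>. \<xi> \<in> X) {..<\<alpha>}"
    have t: "F (\<alpha>, ?t) = g \<alpha>" using * by (simp add: restr_def)
    have "(\<exists>s. F (\<alpha>, s) = g \<alpha> \<and> s \<xi>) \<longleftrightarrow> \<xi> \<in> X" if "\<xi> < \<alpha>" for \<xi>
    proof -
      have "?t \<xi> \<longleftrightarrow> \<xi> \<in> X" using that by simp
      moreover have "s \<xi> = ?t \<xi>" if "F (\<alpha>, s) = g \<alpha>" for s
        using inj[of \<alpha> s ?t \<xi>] that t \<open>\<xi> < \<alpha>\<close> by metis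
      ultimately show ?thesis using t by blast
    qed
    then have "\<xi> \<in> A \<alpha> \<longleftrightarrow> \<xi> \<in> X \<inter> {..<\<alpha>}" for \<xi>
      unfolding A_def by (cases "\<xi> < \<alpha>") simp_all
    then show "X \<inter> {..<\<alpha>} = A \<alpha>" by auto
  qed
  moreover have "A \<alpha> \<subseteq> {..<\<alpha>}" for \<alpha> by (auto simp: A_def)
  ultimately show ?thesis unfolding jensen_diamond_def by blast
qed

theorem proposition4p5:
  "diamond_inv (UNIV :: real set) (UNIV :: real set) {(x, y). x = y} \<longleftrightarrow> jensen_diamond"
proof
  assume "diamond_inv (UNIV :: real set) (UNIV :: real set) {(x, y). x = y}"
  then obtain g where "stationary {\<alpha>. level_code (restr f \<alpha>) = g \<alpha>}" for f
    using borel_map_level_code unfolding diamond_inv_def by auto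
  then show jensen_diamond
    by (rule guessing_injective_code_imp_jensen_diamond[where F = level_code, rotated])
      (rule level_code_inj)
next
  assume jensen_diamond
  then show "diamond_inv (UNIV :: real set) (UNIV :: real set) {(x, y). x = y}"
    unfolding diamond_inv_def by (auto intro: jensen_diamond_guesses_values)
qed

end
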